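(* Let $(J,\mathcal{B})$ be a set algebra. Every bounded weakly infinite-alternating set function $\psi\colon\mathcal{B}\to\mathbb{R}$ can be written as $\psi=\varphi-\mu$, where $\varphi\colon\mathcal{B}\to\mathbb{R}$ is an infinite-alternating set function and $\mu\colon\mathcal{B}\to\mathbb{R}$ is a nonnegative charge.
   Context: A set algebra $(J,\mathcal{B})$ is a set $J$ with a family $\mathcal{B}$ of subsets of $J$ closed under complements and finite unions. A set function $\psi\colon\mathcal{B}\to\mathbb{R}$ is bounded if there is $b\in\mathbb{R}$ with $-b\le\psi(X)\le b$ for all $X\in\mathcal{B}$. A charge is a (not necessarily nonnegative) real-valued finitely additive measure on $\mathcal{B}$. For $\varphi\colon\mathcal{B}\to\mathbb{R}$, a positive integer $k$ and $A_0,\dots,A_k\in\mathcal{B}$, let $V_\varphi(A_0;A_1,\dots,A_k)=\sum_{K\subseteq\{1,\dots,k\}}(-1)^{|K|}\varphi\bigl(A_0\cup\bigcup_{i\in K}A_i\bigr)$. The function $\varphi$ is $k$-alternating if $\varphi(\emptyset)=0$ and $V_\varphi(A_0;A_1,\dots,A_k)\le 0$ for all $A_0,\dots,A_k\in\mathcal{B}$; it is infinite-alternating if it is $k$-alternating for every positive integer $k$. It is weakly $k$-alternating if $\varphi(\emptyset)=0$ and $V_\varphi(A_0;A_1,\dots,A_k)\le 0$ for all pairwise disjoint $A_0,\dots,A_k\in\mathcal{B}$; it is weakly infinite-alternating if it is weakly $k$-alternating for every $k\ge 2$. *)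

theory Defs
  imports "HOL-Analysis.Measure_Space"
begin

text \<open>
  A set algebra \<open>(J, \<B>)\<close> is the locale \<^locale>\<open>algebra\<close>. Real-valued set functions on \<open>\<B>\<close> are
  total functions on \<open>'a set\<close> whose values outside \<open>\<B>\<close> are irrelevant: every notion below
  evaluates them on members of \<open>\<B>\<close> only.
\<close>

definition alt_sum :: "('a set \<Rightarrow> real) \<Rightarrow> nat \<Rightarrow> (nat \<Rightarrow> 'a set) \<Rightarrow> real"
  where "alt_sum \<phi> k A = (\<Sum>K\<in>Pow {1..k}. (-1) ^ card K * \<phi> (A 0 \<union> (\<Union>i\<in>K. A i)))"

text \<open>
  A tuple \<open>A\<^sub>0, \<dots>, A\<^sub>k\<close> is a function on \<^typ>\<open>nat\<close> restricted to the indices \<open>0..k\<close>.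
  The number \<open>k\<close> is meant to be positive.
\<close>

definition k_alternating :: "'a set set \<Rightarrow> nat \<Rightarrow> ('a set \<Rightarrow> real) \<Rightarrow> bool"
  where "k_alternating \<B> k \<phi> \<longleftrightarrow>
    \<phi> {} = 0 \<and> (\<forall>A. (\<forall>i\<in>{0..k}. A i \<in> \<B>) \<longrightarrow> alt_sum \<phi> k A \<le> 0)"

definition infinite_alternating :: "'a set set \<Rightarrow> ('a set \<Rightarrow> real) \<Rightarrow> bool"
  where "infinite_alternating \<B> \<phi> \<longleftrightarrow> (\<forall>k\<ge>1. k_alternating \<B> k \<phi>)"

text \<open>
  Pairwise disjointness is that of the indexed family, including \<open>A\<^sub>0\<close>; members may be empty
  and the empty set may repeat.
\<close>

definition weakly_k_alternating :: "'a set set \<Rightarrow> nat \<Rightarrow> ('a set \<Rightarrow> real) \<Rightarrow> bool"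
  where "weakly_k_alternating \<B> k \<phi> \<longleftrightarrow>
    \<phi> {} = 0 \<and>
    (\<forall>A. (\<forall>i\<in>{0..k}. A i \<in> \<B>) \<and> disjoint_family_on A {0..k} \<longrightarrow> alt_sum \<phi> k A \<le> 0)"

text \<open>The weak notion starts at \<open>k = 2\<close>, so it does not force \<open>\<phi>\<close> to be increasing.\<close>

definition weakly_infinite_alternating :: "'a set set \<Rightarrow> ('a set \<Rightarrow> real) \<Rightarrow> bool"
  where "weakly_infinite_alternating \<B> \<phi> \<longleftrightarrow> (\<forall>k\<ge>2. weakly_k_alternating \<B> k \<phi>)"

definition bounded_set_function :: "'a set set \<Rightarrow> ('a set \<Rightarrow> real) \<Rightarrow> bool"
  where "bounded_set_function \<B> \<psi> \<longleftrightarrow> (\<exists>b. \<forall>X\<in>\<B>. - b \<le> \<psi> X \<and> \<psi> X \<le> b)"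

text \<open>On a set algebra, \<^const>\<open>additive\<close> entails that the empty set has value 0.\<close>

definition charge :: "'a set set \<Rightarrow> ('a set \<Rightarrow> real) \<Rightarrow> bool"
  where "charge \<B> \<mu> \<longleftrightarrow> additive \<B> \<mu>"

end

theory Submission
  imports Defs
begin

text \<open>
  Write \<open>\<Delta>\<^sub>A g(X) = g(X) - g(X \<union> A)\<close>. Then \<open>alt_sum g k A\<close> is the iterated difference
  \<open>\<Delta>\<^bsub>A 1\<^esub> \<dots> \<Delta>\<^bsub>A k\<^esub> g(A 0)\<close>, and both notions of alternation say that such
  iterated differences are nonpositive.

  Two differences at disjoint sets being nonpositive is submodularity of \<open>\<psi>\<close>, so among all
  \<open>X\<close> disjoint from \<open>A\<close> the decrement \<open>\<psi>(X) - \<psi>(X \<union> A)\<close> is largest at the complement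
  of \<open>A\<close>, where it equals \<open>\<rho>(A) = \<psi>(J - A) - \<psi>(J)\<close>. Hence \<open>\<psi> + \<mu>\<close> is increasing as soon
  as \<open>\<mu>\<close> is a charge above \<open>\<rho>\<close>, while the higher differences at disjoint sets are not changed by
  adding a charge (\<open>iter_diff_additive\<close>). Submodularity also makes \<open>\<rho>\<close> subadditive on disjoint
  sets, and for such a \<open>\<rho>\<close> the supremum \<open>\<mu>(A)\<close> of the sums \<open>\<rho>(A\<^sub>1) + \<dots> + \<rho>(A\<^sub>n)\<close> over disjoint
  subsets \<open>A\<^sub>i\<close> of \<open>A\<close> is a nonnegative charge above \<open>\<rho>\<close> (\<open>upper_charge_properties\<close>), provided
  that these sums are bounded.

  The bound is the heart of the matter; submodularity does not suffice for it, as
  \<open>f(\<lambda>(A))\<close> shows for Lebesgue measure \<open>\<lambda>\<close> on the unit interval and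
  \<open>f(t) = sqrt (1 - t) - 1\<close>.

  On a finite set, a weakly infinite-alternating \<open>\<psi>\<close> is a combination of the functions
  \<open>e\<^sub>K(A) = (if K \<inter> A \<noteq> {} then 1 else 0)\<close> whose coefficients are nonnegative for \<open>|K| \<ge> 2\<close>, and the
  coefficient at a singleton is the negative of \<open>\<rho>\<close> there. Let \<open>E\<close> be the mean of \<open>\<psi>\<close> over all
  subsets, so that \<open>E = 1 - 1 / 2 ^ |K|\<close> for \<open>\<psi> = e\<^sub>K\<close>. Then the sum of \<open>\<rho>\<close> over the points is
  at most \<open>4 * E - 3 * \<psi>(J)\<close>: both sides are linear in \<open>\<psi>\<close>, for \<open>|K| = 1\<close> the function
  \<open>e\<^sub>K\<close> gives \<open>-1\<close> on both, and for \<open>|K| \<ge> 2\<close> it gives \<open>0 \<le> 1 - 4 / 2 ^ |K|\<close>.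
  The lemma \<open>sum_decrements_le_mean\<close> proves this inequality by induction on the number of sets, from third differences alone.

  It remains to pass from disjoint sets to arbitrary ones, which is possible once first
  differences are nonpositive too (\<open>iter_diff_nonpos\<close>).
\<close>

section \<open>Iterated differences\<close>

primrec iter_diff :: "('a set \<Rightarrow> real) \<Rightarrow> 'a set list \<Rightarrow> 'a set \<Rightarrow> real" where
  "iter_diff g [] X = g X"
| "iter_diff g (A # l) X = iter_diff g l X - iter_diff g l (X \<union> A)"

definition disjoint_list :: "'a set set \<Rightarrow> 'a set list \<Rightarrow> bool"
  where "disjoint_list M l \<longleftrightarrow> set l \<subseteq> M \<and> sorted_wrt disjnt l"

definition nonpos_diffs :: "'a set set \<Rightarrow> nat \<Rightarrow> ('a set \<Rightarrow> real) \<Rightarrow> bool"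
  where "nonpos_diffs M n g \<longleftrightarrow>
    (\<forall>l X. n \<le> length l \<longrightarrow> disjoint_list M l \<longrightarrow> X \<in> M \<longrightarrow> iter_diff g l X \<le> 0)"

lemma nonpos_diffsD:
  "nonpos_diffs M n g \<Longrightarrow> n \<le> length l \<Longrightarrow> disjoint_list M l \<Longrightarrow> X \<in> M \<Longrightarrow> iter_diff g l X \<le> 0"
  by (simp add: nonpos_diffs_def)

lemma alt_sum_Suc:
  "alt_sum g (Suc k) A = alt_sum g k A - alt_sum g k (A(0 := A 0 \<union> A (Suc k)))"
proof -
  let ?P = "Pow {1..k}"
  let ?f = "\<lambda>A K. (-1) ^ card K * g (A 0 \<union> (\<Union>i\<in>K. A i))"
  have range: "{1..Suc k} = insert (Suc k) {1..k}"
    by auto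
  have inj: "inj_on (insert (Suc k)) ?P"
    by (rule inj_on_inverseI[where g = "\<lambda>K. K - {Suc k}"]) auto
  have new: "?f A (insert (Suc k) K) = - ?f (A(0 := A 0 \<union> A (Suc k))) K" if "K \<in> ?P" for K
  proof -
    have "finite K" "Suc k \<notin> K"
      using that by (auto dest: finite_subset)
    moreover have "(\<Union>i\<in>K. (A(0 := A 0 \<union> A (Suc k))) i) = (\<Union>i\<in>K. A i)"
      using that by (intro SUP_cong) auto
    ultimately show ?thesis
      by (simp add: Un_assoc)
  qed
  have "alt_sum g (Suc k) A = (\<Sum>K\<in>?P. ?f A K) + (\<Sum>K\<in>insert (Suc k) ` ?P. ?f A K)"
    unfolding alt_sum_def range Pow_insert by (rule sum.union_disjoint) auto
  also have "(\<Sum>K\<in>insert (Suc k) ` ?P. ?f A K) = (\<Sum>K\<in>?P. ?f A (insert (Suc k) K))"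
    using sum.reindex[OF inj, of "?f A"] by (simp add: comp_def)
  also have "\<dots> = (\<Sum>K\<in>?P. - ?f (A(0 := A 0 \<union> A (Suc k))) K)"
    using new by (intro sum.cong) simp_all
  finally show ?thesis
    by (simp only: sum_negf alt_sum_def)
qed

lemma alt_sum_eq_iter_diff:
  "alt_sum g k A = iter_diff g (map A (rev [1..<Suc k])) (A 0)"
proof (induction k arbitrary: A)
  case 0
  show ?case by (simp add: alt_sum_def)
next
  case (Suc k)
  have "map (A(0 := A 0 \<union> A (Suc k))) (rev [1..<Suc k]) = map A (rev [1..<Suc k])"
    by (rule map_cong) auto
  then show ?case
    unfolding alt_sum_Suc Suc.IH by simp
qed

text \<open>
  A difference at \<open>Y\<close> sees only the part of each set that lies outside \<open>Y\<close>, so in the following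
  rule it costs nothing to take the base point disjoint from the sets of the list.
\<close>

lemma iter_diff_base_shift: "X \<subseteq> Y \<Longrightarrow> iter_diff g (map (\<lambda>L. L - X) l) Y = iter_diff g l Y"
proof (induction l arbitrary: Y)
  case (Cons A l)
  then have "Y \<union> (A - X) = Y \<union> A" by blast
  moreover have "X \<subseteq> Y \<union> A" using Cons.prems by blast
  ultimately show ?case using Cons by simp
qed simp

lemma nonpos_diffsI:
  assumes "algebra \<Omega> M"
    and "\<And>l X. n \<le> length l \<Longrightarrow> disjoint_list M l \<Longrightarrow> X \<in> M \<Longrightarrow> \<forall>L\<in>set l. disjnt X L
      \<Longrightarrow> iter_diff g l X \<le> 0"
  shows "nonpos_diffs M n g"
  unfolding nonpos_diffs_def
proof (intro allI impI)
  fix l X assume l: "n \<le> length l" "disjoint_list M l" and X: "X \<in> M"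
  interpret algebra \<Omega> M by fact
  have "disjoint_list M (map (\<lambda>L. L - X) l)"
    using l X unfolding disjoint_list_def
    by (auto simp: sorted_wrt_map disjnt_def elim!: sorted_wrt_mono_rel[rotated])
  then have "iter_diff g (map (\<lambda>L. L - X) l) X \<le> 0"
    using l X by (intro assms(2)) (auto simp: disjnt_def)
  then show "iter_diff g l X \<le> 0"
    by (simp add: iter_diff_base_shift)
qed

lemma iter_diff_Cons: "iter_diff g (A # l) X = iter_diff (\<lambda>Y. g Y - g (Y \<union> A)) l X"
proof (induction l arbitrary: X)
  case (Cons B l)
  show ?case
    using Cons[of X] Cons[of "X \<union> B"] by (simp add: Un_assoc Un_commute[of A B])
qed simp

lemma iter_diff_add: "iter_diff (\<lambda>Y. g Y + h Y) l X = iter_diff g l X + iter_diff h l X"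
  by (induction l arbitrary: X) simp_all

lemma iter_diff_swap: "iter_diff g (A # l1 @ l2) X = iter_diff g (l1 @ A # l2) X"
proof (induction l1 arbitrary: X)
  case (Cons B l1)
  have "iter_diff g (l1 @ A # l2) Y = iter_diff g (l1 @ l2) Y - iter_diff g (l1 @ l2) (Y \<union> A)" for Y
    using Cons.IH[of Y] by simp
  then show ?case by (simp add: Un_ac)
qed simp

lemma iter_diff_cong:
  "(\<And>Y. iter_diff g l1 Y = iter_diff g l2 Y) \<Longrightarrow> iter_diff g (l @ l1) X = iter_diff g (l @ l2) X"
  by (induction l arbitrary: X) simp_all

text \<open>For \<open>B \<subseteq> L\<close> one has \<open>\<Delta>\<^sub>B \<Delta>\<^sub>L = \<Delta>\<^sub>B\<close>, since \<open>Y \<union> B \<union> L = Y \<union> L\<close>.\<close>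

lemma iter_diff_absorb:
  assumes "B \<subseteq> L"
  shows "iter_diff g (B # l1 @ L # l2) X = iter_diff g (l1 @ B # l2) X"
proof -
  have "iter_diff g (B # L # l2) Y = iter_diff g (B # l2) Y" for Y
  proof -
    have "Y \<union> B \<union> L = Y \<union> L" using assms by blast
    then show ?thesis by simp
  qed
  then show ?thesis
    unfolding iter_diff_swap by (rule iter_diff_cong)
qed

lemma iter_diff_split:
  "iter_diff g (A # l) X = iter_diff g ((A \<inter> L) # l) X + iter_diff g ((A - L) # l) (X \<union> (A \<inter> L))"
proof -
  have "X \<union> (A \<inter> L) \<union> (A - L) = X \<union> A" by blast
  then show ?thesis by simp
qed

section \<open>From disjoint to arbitrary sets\<close>

text \<open>
  One arbitrary set \<open>A\<close> may be added to a disjoint list. The list is traversed, and \<open>A\<close> is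
  disjoint from the part \<open>l1\<close> already passed. At the next member \<open>L\<close>, the set \<open>A\<close> is split into
  \<open>A \<inter> L\<close> and \<open>A - L\<close>: the first piece absorbs \<open>L\<close> and leaves a disjoint list, the second one
  continues the traversal.
\<close>

lemma iter_diff_nonpos_insert:
  assumes "algebra \<Omega> M" "nonpos_diffs M 1 g" "A \<in> M" "X \<in> M"
    and "disjoint_list M (l1 @ l2)" "\<forall>L\<in>set l1. disjnt A L"
  shows "iter_diff g (A # l1 @ l2) X \<le> 0"
  using assms(3-)
proof (induction l2 arbitrary: A X l1)
  case Nil
  then have "disjoint_list M (A # l1)"
    by (simp add: disjoint_list_def)
  then show ?case
    using nonpos_diffsD[OF assms(2), of "A # l1" X] Nil by simp
next
  case (Cons L l2)
  interpret algebra \<Omega> M by fact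
  have L: "L \<in> M"
    using Cons.prems by (simp add: disjoint_list_def)
  have "disjoint_list M (l1 @ (A \<inter> L) # l2)"
    using Cons.prems L unfolding disjoint_list_def disjnt_def by (auto simp: sorted_wrt_append)
  then have "iter_diff g ((A \<inter> L) # l1 @ L # l2) X \<le> 0"
    using nonpos_diffsD[OF assms(2)] Cons.prems by (subst iter_diff_absorb) auto
  moreover have "iter_diff g ((A - L) # (l1 @ [L]) @ l2) (X \<union> (A \<inter> L)) \<le> 0"
    using Cons.prems L by (intro Cons.IH) (auto simp: disjnt_def)
  ultimately show ?case
    using iter_diff_split[of g A "l1 @ L # l2" X L] by simp
qed

text \<open>
  By the preceding lemma, \<open>\<Delta>\<^sub>A g\<close> inherits from \<open>g\<close> the hypothesis on disjoint lists, so the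
  sets can be dealt with one after the other.
\<close>

lemma iter_diff_nonpos:
  assumes "algebra \<Omega> M" "nonpos_diffs M 1 g" "set l \<subseteq> M" "l \<noteq> []" "X \<in> M"
  shows "iter_diff g l X \<le> 0"
  using assms(2-)
proof (induction l arbitrary: g X)
  case (Cons A l)
  have ins: "iter_diff g (A # l') Y \<le> 0" if "disjoint_list M l'" "Y \<in> M" for l' Y
    using iter_diff_nonpos_insert[OF assms(1) Cons.prems(1), of A Y "[]" l'] that Cons.prems by simp
  show ?case
  proof (cases "l = []")
    case True
    then show ?thesis using ins[of "[]" X] Cons.prems by (simp add: disjoint_list_def)
  next
    case False
    have "nonpos_diffs M 1 (\<lambda>Y. g Y - g (Y \<union> A))"
      unfolding nonpos_diffs_def iter_diff_Cons[symmetric] using ins by blast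
    then show ?thesis
      unfolding iter_diff_Cons using Cons.IH Cons.prems False by simp
  qed
qed simp

lemma infinite_alternatingI:
  assumes "algebra \<Omega> M" "g {} = 0" "nonpos_diffs M 1 g"
  shows "infinite_alternating M g"
  unfolding infinite_alternating_def k_alternating_def
proof (intro allI impI conjI)
  fix k :: nat and A :: "nat \<Rightarrow> 'a set"
  assume k: "1 \<le> k" and A: "\<forall>i\<in>{0..k}. A i \<in> M"
  let ?l = "map A (rev [1..<Suc k])"
  have "set ?l = A ` {1..k}"
    by (simp only: set_map set_rev set_upt atLeastLessThanSuc_atLeastAtMost)
  then have "set ?l \<subseteq> M" "?l \<noteq> []"
    using A k by (simp_all only: image_subset_iff set_empty[symmetric]) simp_all
  moreover have "A 0 \<in> M"
    using A by simp
  ultimately show "alt_sum g k A \<le> 0"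
    unfolding alt_sum_eq_iter_diff by (rule iter_diff_nonpos[OF assms(1,3)])
qed (rule assms(2))

lemma weakly_infinite_alternating_diffs:
  assumes "algebra \<Omega> M" "weakly_infinite_alternating M g"
  shows "nonpos_diffs M 2 g"
proof (rule nonpos_diffsI[OF assms(1)])
  fix l :: "'a set list" and X
  assume l: "2 \<le> length l" "disjoint_list M l" and X: "X \<in> M" "\<forall>L\<in>set l. disjnt X L"
  let ?A = "\<lambda>i. (X # rev l) ! i"
  have disjnt_iff_comm: "disjnt A B \<longleftrightarrow> disjnt B A" for A B :: "'a set"
    using disjnt_sym by blast
  have disj: "sorted_wrt disjnt (X # rev l)"
    using l(2) X(2) by (simp add: disjoint_list_def sorted_wrt_rev disjnt_iff_comm)
  have "disjoint_family_on ?A {0..length l}"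
    unfolding disjoint_family_on_def
  proof (intro ballI impI)
    fix i j assume ij: "i \<in> {0..length l}" "j \<in> {0..length l}" "i \<noteq> j"
    then consider "i < j" | "j < i" by linarith
    then show "?A i \<inter> ?A j = {}"
      using sorted_wrt_nth_less[OF disj, of i j] sorted_wrt_nth_less[OF disj, of j i] ij
      by cases (auto simp: disjnt_def simp del: nth_Cons_Suc)
  qed
  moreover have "?A i \<in> M" if "i \<in> {0..length l}" for i
  proof -
    have "?A i \<in> set (X # rev l)"
      using that by (intro nth_mem) simp
    then show ?thesis
      using X l(2) unfolding disjoint_list_def by (metis insert_iff list.set(2) set_rev subsetD)
  qed
  ultimately have "alt_sum g (length l) ?A \<le> 0"
    using assms(2) l(1) unfolding weakly_infinite_alternating_def weakly_k_alternating_def by blast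
  moreover have "map ?A (rev [1..<Suc (length l)]) = l"
    by (rule nth_equalityI) (auto simp: rev_nth nth_Cons' simp del: upt_Suc)
  ultimately show "iter_diff g l X \<le> 0"
    unfolding alt_sum_eq_iter_diff by simp
qed

section \<open>The least nonnegative charge above a subadditive set function\<close>

definition packings :: "'a set set \<Rightarrow> 'a set \<Rightarrow> 'a set list set"
  where "packings M A = {l. disjoint_list M l \<and> \<Union>(set l) \<subseteq> A}"

definition upper_charge :: "'a set set \<Rightarrow> ('a set \<Rightarrow> real) \<Rightarrow> 'a set \<Rightarrow> real"
  where "upper_charge M \<rho> A = (SUP l\<in>packings M A. sum_list (map \<rho> l))"

text \<open>
  Subadditivity of the supremum comes from cutting each member of a disjoint list inside
  \<open>A \<union> B\<close> into its parts in \<open>A\<close> and in \<open>B\<close>, superadditivity from concatenating lists inside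
  \<open>A\<close> and inside \<open>B\<close>. The empty list gives nonnegativity. Every nonnegative charge above \<open>\<rho>\<close>
  bounds these sums, so this is the least one.
\<close>

lemma upper_charge_properties:
  fixes \<rho> :: "'a set \<Rightarrow> real"
  assumes "algebra \<Omega> M"
    and sub: "\<And>S T. S \<in> M \<Longrightarrow> T \<in> M \<Longrightarrow> disjnt S T \<Longrightarrow> \<rho> (S \<union> T) \<le> \<rho> S + \<rho> T"
    and bound: "\<And>l. disjoint_list M l \<Longrightarrow> sum_list (map \<rho> l) \<le> c"
  shows upper_charge_additive: "additive M (upper_charge M \<rho>)"
    and upper_charge_nonneg: "0 \<le> upper_charge M \<rho> A"
    and upper_charge_ge: "A \<in> M \<Longrightarrow> \<rho> A \<le> upper_charge M \<rho> A"
proof -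
  interpret algebra \<Omega> M by fact
  let ?\<mu> = "upper_charge M \<rho>"
  have upper: "sum_list (map \<rho> l) \<le> ?\<mu> A" if "l \<in> packings M A" for l A
    unfolding upper_charge_def using that bound
    by (intro cSUP_upper bdd_aboveI2[where M = c]) (auto simp: packings_def)
  have least: "?\<mu> A \<le> z" if "\<And>l. l \<in> packings M A \<Longrightarrow> sum_list (map \<rho> l) \<le> z" for A z
  proof -
    have "[] \<in> packings M A" by (simp add: packings_def disjoint_list_def)
    then show ?thesis unfolding upper_charge_def using that by (intro cSUP_least) auto
  qed
  show "0 \<le> ?\<mu> A" for A
    using upper[of "[]" A] by (simp add: packings_def disjoint_list_def)
  show "\<rho> A \<le> ?\<mu> A" if "A \<in> M" for A
    using upper[of "[A]" A] that by (simp add: packings_def disjoint_list_def)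
  show "additive M ?\<mu>"
    unfolding additive_def
  proof (intro ballI impI antisym)
    fix A B assume AB: "A \<in> M" "B \<in> M" "A \<inter> B = {}"
    show "?\<mu> (A \<union> B) \<le> ?\<mu> A + ?\<mu> B"
    proof (rule least)
      fix l assume l: "l \<in> packings M (A \<union> B)"
      have restrict: "map (\<lambda>C. C \<inter> D) l \<in> packings M D" if "D \<in> M" for D
        using l that unfolding packings_def disjoint_list_def
        by (auto simp: sorted_wrt_map disjnt_def elim!: sorted_wrt_mono_rel[rotated])
      have split: "\<rho> C \<le> \<rho> (C \<inter> A) + \<rho> (C \<inter> B)" if "C \<in> set l" for C
      proof -
        have "C \<in> M" "(C \<inter> A) \<union> (C \<inter> B) = C"
          using l that by (auto simp: packings_def disjoint_list_def)
        then show ?thesis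
          using sub[of "C \<inter> A" "C \<inter> B"] AB by (auto simp: disjnt_def)
      qed
      have "sum_list (map \<rho> l) \<le> (\<Sum>C\<leftarrow>l. \<rho> (C \<inter> A) + \<rho> (C \<inter> B))"
        by (rule sum_list_mono) (rule split)
      also have "\<dots> = (\<Sum>C\<leftarrow>map (\<lambda>C. C \<inter> A) l. \<rho> C) + (\<Sum>C\<leftarrow>map (\<lambda>C. C \<inter> B) l. \<rho> C)"
        by (simp add: sum_list_addf comp_def)
      also have "\<dots> \<le> ?\<mu> A + ?\<mu> B"
        using AB by (intro add_mono upper restrict)
      finally show "sum_list (map \<rho> l) \<le> ?\<mu> A + ?\<mu> B" .
    qed
    have join: "sum_list (map \<rho> l) + sum_list (map \<rho> l') \<le> ?\<mu> (A \<union> B)"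
      if "l \<in> packings M A" "l' \<in> packings M B" for l l'
    proof -
      have "l @ l' \<in> packings M (A \<union> B)"
        using that AB(3) unfolding packings_def disjoint_list_def
        by (auto simp: sorted_wrt_append disjnt_def; blast)
      from upper[OF this] show ?thesis by simp
    qed
    have "?\<mu> A \<le> ?\<mu> (A \<union> B) - ?\<mu> B"
    proof (rule least)
      fix l assume l: "l \<in> packings M A"
      have "?\<mu> B \<le> ?\<mu> (A \<union> B) - sum_list (map \<rho> l)"
        using join[OF l] by (intro least) (simp add: algebra_simps)
      then show "sum_list (map \<rho> l) \<le> ?\<mu> (A \<union> B) - ?\<mu> B" by simp
    qed
    then show "?\<mu> A + ?\<mu> B \<le> ?\<mu> (A \<union> B)" by simp
  qed
qed

lemma iter_diff_additive:
  assumes "algebra \<Omega> M" "additive M \<mu>" "disjoint_list M (A # l)" "X \<in> M"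
    and "\<forall>L\<in>set (A # l). disjnt X L"
  shows "iter_diff \<mu> (A # l) X = (if l = [] then - \<mu> A else 0)"
  using assms(3-)
proof (induction l arbitrary: A X)
  case Nil
  then show ?case
    using additiveD[OF assms(2), of X A] by (simp add: disjoint_list_def disjnt_def)
next
  case (Cons B l)
  interpret algebra \<Omega> M by fact
  have "iter_diff \<mu> (B # l) X = (if l = [] then - \<mu> B else 0)"
    using Cons.prems by (intro Cons.IH) (auto simp: disjoint_list_def)
  moreover have "iter_diff \<mu> (B # l) (X \<union> A) = (if l = [] then - \<mu> B else 0)"
    using Cons.prems by (intro Cons.IH) (auto simp: disjoint_list_def disjnt_def)
  ultimately show ?case
    by (simp only: iter_diff.simps(2)[of _ A]) simp
qed

section \<open>Boundedness of the decrements\<close>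

text \<open>
  The mean of \<open>g (X \<union> \<Union>S)\<close> over all sublists \<open>S\<close> of the list.
\<close>

primrec subset_mean :: "('a set \<Rightarrow> real) \<Rightarrow> 'a set list \<Rightarrow> 'a set \<Rightarrow> real" where
  "subset_mean g [] X = g X"
| "subset_mean g (A # l) X = (subset_mean g l X + subset_mean g l (X \<union> A)) / 2"

lemma subset_mean_diff:
  "subset_mean (\<lambda>Y. g Y - g (Y \<union> A)) l X = subset_mean g l X - subset_mean g l (X \<union> A)"
proof (induction l arbitrary: X)
  case (Cons B l)
  show ?case
    using Cons[of X] Cons[of "X \<union> B"] by (simp add: Un_assoc Un_commute[of A B] field_simps)
qed simp

lemma subset_mean_le:
  assumes "algebra \<Omega> M" "\<And>Y. Y \<in> M \<Longrightarrow> g Y \<le> b" "set l \<subseteq> M" "X \<in> M"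
  shows "subset_mean g l X \<le> b"
  using assms(3-)
proof (induction l arbitrary: X)
  case Nil
  then show ?case using assms(2) by simp
next
  case (Cons A l)
  interpret algebra \<Omega> M by fact
  have "subset_mean g l X \<le> b" "subset_mean g l (X \<union> A) \<le> b"
    using Cons by auto
  then show ?case by simp
qed

lemma UNION_in_algebra:
  assumes "algebra \<Omega> M" "disjoint_list M l"
  shows "\<Union>(set l) \<in> M"
proof -
  interpret algebra \<Omega> M by fact
  show ?thesis using assms(2) by (auto simp: disjoint_list_def)
qed

text \<open>
  If \<open>g\<close> is submodular above \<open>X\<close>, then \<open>g(X) + g(X \<union> U) \<le> g(X \<union> S) + g(X \<union> (U - S))\<close> for
  each union \<open>S\<close> of members of the list with total union \<open>U\<close>; averaging over \<open>S\<close> counts every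
  term on the right twice.
\<close>

lemma endpoints_le_subset_mean:
  assumes "algebra \<Omega> M" "disjoint_list M l" "X \<in> M"
    and "\<And>S T Y. disjoint_list M [S, T] \<Longrightarrow> S \<union> T \<subseteq> \<Union>(set l) \<Longrightarrow> Y \<in> M
      \<Longrightarrow> iter_diff g [S, T] Y \<le> 0"
  shows "g X + g (X \<union> \<Union>(set l)) \<le> 2 * subset_mean g l X"
  using assms(2-)
proof (induction l arbitrary: X)
  case (Cons A l)
  interpret algebra \<Omega> M by fact
  let ?U = "\<Union>(set l)"
  have l: "disjoint_list M l" "A \<in> M"
    using Cons.prems by (auto simp: disjoint_list_def)
  have IH: "g Y + g (Y \<union> ?U) \<le> 2 * subset_mean g l Y" if "Y \<in> M" for Y
    using l that Cons.prems(3) by (intro Cons.IH) (auto simp: le_supI2)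
  have "disjoint_list M [A, ?U]"
    using Cons.prems(1) UNION_in_algebra[OF assms(1) l(1)]
    by (auto simp: disjoint_list_def disjnt_def)
  then have "iter_diff g [A, ?U] X \<le> 0"
    using Cons.prems by simp
  moreover have "X \<union> A \<in> M" using Cons.prems l by auto
  ultimately show ?case
    using IH[of X] IH[of "X \<union> A"] Cons.prems(2) by (simp add: Un_ac)
qed simp

text \<open>
  When a set \<open>A\<close> is added to the list, the base point drops from \<open>X \<union> A\<close> to \<open>X\<close>. The required
  increase of the right-hand side is exactly the previous lemma for \<open>\<Delta>\<^sub>A g\<close>, which is submodular
  away from \<open>A\<close> because third differences of \<open>g\<close> are nonpositive. Equality holds for the empty
  list.
\<close>

lemma sum_decrements_le_mean:
  assumes "algebra \<Omega> M" "nonpos_diffs M 2 g" "disjoint_list M l"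
  shows "(\<Sum>A\<leftarrow>l. g (\<Omega> - A) - g \<Omega>)
    \<le> 4 * subset_mean g l (\<Omega> - \<Union>(set l)) - 3 * g \<Omega> - g (\<Omega> - \<Union>(set l))"
  using assms(3)
proof (induction l)
  case (Cons A l)
  interpret algebra \<Omega> M by fact
  let ?U = "\<Union>(set l)" and ?d = "\<lambda>Y. g Y - g (Y \<union> A)"
  define s where "s = (\<Sum>A\<leftarrow>l. g (\<Omega> - A) - g \<Omega>)"
  define X where "X = \<Omega> - (A \<union> ?U)"
  have l: "disjoint_list M l" "A \<in> M" "A \<inter> ?U = {}"
    using Cons.prems by (auto simp: disjoint_list_def disjnt_def)
  have U: "?U \<in> M"
    by (rule UNION_in_algebra[OF assms(1) l(1)])
  have sub: "A \<subseteq> \<Omega>" "?U \<subseteq> \<Omega>"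
    using l U sets_into_space by blast+
  have X: "X \<in> M" "X \<union> ?U = \<Omega> - A" "X \<union> ?U \<union> A = \<Omega>" "X \<union> A = \<Omega> - ?U"
    using l U sub unfolding X_def by auto
  have base: "\<Omega> - \<Union>(set (A # l)) = X"
    by (simp add: X_def)
  have "?d X + ?d (X \<union> ?U) \<le> 2 * subset_mean ?d l X"
  proof (rule endpoints_le_subset_mean[OF assms(1) l(1) X(1)])
    fix S T Y assume ST: "disjoint_list M [S, T]" "S \<union> T \<subseteq> ?U" "Y \<in> M"
    have "disjoint_list M [A, S, T]"
      using ST l(2,3) by (auto simp: disjoint_list_def disjnt_def)
    then have "iter_diff g [A, S, T] Y \<le> 0"
      using nonpos_diffsD[OF assms(2)] ST(3) by force
    then show "iter_diff ?d [S, T] Y \<le> 0"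
      unfolding iter_diff_Cons[of g A] .
  qed
  then have "?d X + ?d (X \<union> ?U) \<le> 2 * subset_mean g l X - 2 * subset_mean g l (X \<union> A)"
    unfolding subset_mean_diff by simp
  moreover have "s \<le> 4 * subset_mean g l (X \<union> A) - 3 * g \<Omega> - g (X \<union> A)"
    using Cons.IH[OF l(1)] unfolding X(4) s_def .
  moreover have "?d (X \<union> ?U) = g (\<Omega> - A) - g \<Omega>"
    by (simp only: X(2,3) X(3)[unfolded X(2)])
  ultimately show ?case
    unfolding list.map sum_list.Cons base subset_mean.simps s_def[symmetric] by argo
qed simp

section \<open>The decomposition\<close>

theorem corollary6p5:
  fixes J :: "'a set" and \<B> :: "'a set set" and \<psi> :: "'a set \<Rightarrow> real"
  assumes "algebra J \<B>"
    and "bounded_set_function \<B> \<psi>"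
    and "weakly_infinite_alternating \<B> \<psi>"
  shows "\<exists>(\<phi> :: 'a set \<Rightarrow> real) (\<mu> :: 'a set \<Rightarrow> real).
    infinite_alternating \<B> \<phi> \<and> charge \<B> \<mu> \<and> (\<forall>X\<in>\<B>. 0 \<le> \<mu> X) \<and>
    (\<forall>X\<in>\<B>. \<psi> X = \<phi> X - \<mu> X)"
proof -
  interpret algebra J \<B> by fact
  note diffs = nonpos_diffsD[OF weakly_infinite_alternating_diffs[OF assms(1,3)]]
  define \<rho> where "\<rho> A = \<psi> (J - A) - \<psi> J" for A
  define \<mu> where "\<mu> = upper_charge \<B> \<rho>"
  define \<phi> where "\<phi> X = \<psi> X + \<mu> X" for X
  obtain b where b: "\<And>X. X \<in> \<B> \<Longrightarrow> - b \<le> \<psi> X" "\<And>X. X \<in> \<B> \<Longrightarrow> \<psi> X \<le> b"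
    using assms(2) unfolding bounded_set_function_def by blast
  \<comment> \<open>The second difference at \<open>S\<close> and \<open>T\<close>, based at the complement of \<open>S \<union> T\<close>.\<close>
  have sub: "\<rho> (S \<union> T) \<le> \<rho> S + \<rho> T" if ST: "S \<in> \<B>" "T \<in> \<B>" "disjnt S T" for S T
  proof -
    define Y where "Y = J - (S \<union> T)"
    have eqs: "Y \<union> S = J - T" "Y \<union> T = J - S" "J \<union> T = J"
      using ST sets_into_space unfolding Y_def by (auto simp: disjnt_def)
    have "iter_diff \<psi> [S, T] Y \<le> 0"
      using ST by (intro diffs) (auto simp: disjoint_list_def Y_def)
    then show ?thesis
      unfolding \<rho>_def Y_def[symmetric] by (simp add: eqs)
  qed
  have bound: "sum_list (map \<rho> l) \<le> 8 * b" if l: "disjoint_list \<B> l" for l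
  proof -
    let ?X = "J - \<Union>(set l)"
    have X: "?X \<in> \<B>"
      using UNION_in_algebra[OF assms(1) l] by auto
    have "sum_list (map \<rho> l) \<le> 4 * subset_mean \<psi> l ?X - 3 * \<psi> J - \<psi> ?X"
      using sum_decrements_le_mean[OF assms(1) weakly_infinite_alternating_diffs[OF assms(1,3)] l]
      unfolding \<rho>_def .
    moreover have "subset_mean \<psi> l ?X \<le> b"
      using l X b(2) by (intro subset_mean_le[OF assms(1)]) (auto simp: disjoint_list_def)
    ultimately show ?thesis
      using b(1)[OF X] b(1)[OF top] by linarith
  qed
  have \<mu>_additive: "additive \<B> \<mu>"
    unfolding \<mu>_def by (rule upper_charge_additive[OF assms(1) sub bound])
  have \<mu>_nonneg: "0 \<le> \<mu> A" for A
    unfolding \<mu>_def by (rule upper_charge_nonneg[OF assms(1) sub bound])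
  have \<mu>_ge: "\<rho> A \<le> \<mu> A" if "A \<in> \<B>" for A
    unfolding \<mu>_def by (rule upper_charge_ge[OF assms(1) sub bound that])
  \<comment> \<open>The second difference at \<open>A\<close> and the set that completes \<open>X\<close> to the complement of \<open>A\<close>.\<close>
  have decr: "\<psi> X - \<psi> (X \<union> A) \<le> \<rho> A" if "X \<in> \<B>" "A \<in> \<B>" "disjnt X A" for X A
  proof -
    define T where "T = J - (X \<union> A)"
    have eqs: "X \<union> T = J - A" "J \<union> A = J"
      using that sets_into_space unfolding T_def by (auto simp: disjnt_def)
    have "iter_diff \<psi> [T, A] X \<le> 0"
      using that by (intro diffs) (auto simp: disjoint_list_def T_def disjnt_def)
    then show ?thesis
      by (simp add: \<rho>_def eqs)
  qed
  have "nonpos_diffs \<B> 1 \<phi>"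
  proof (rule nonpos_diffsI[OF assms(1)])
    fix l' X assume l': "1 \<le> length l'" "disjoint_list \<B> l'"
      and X: "X \<in> \<B>" "\<forall>L\<in>set l'. disjnt X L"
    obtain A l where Al: "l' = A # l"
      using l'(1) by (cases l') auto
    note dA = l'(2)[unfolded Al] and disj = X(2)[unfolded Al]
    have "iter_diff \<phi> (A # l) X = iter_diff \<psi> (A # l) X + (if l = [] then - \<mu> A else 0)"
      using iter_diff_additive[OF assms(1) \<mu>_additive dA X(1) disj]
      unfolding \<phi>_def iter_diff_add by (rule arg_cong)
    also have "\<dots> \<le> 0"
    proof (cases "l = []")
      case True
      have A: "A \<in> \<B>" using dA by (simp add: disjoint_list_def)
      then show ?thesis
        using True decr[OF X(1) A] \<mu>_ge[OF A] disj by simp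
    next
      case False
      then have "2 \<le> length (A # l)" by (cases l) auto
      then show ?thesis
        using False diffs[OF _ dA X(1)] by simp
    qed
    finally show "iter_diff \<phi> l' X \<le> 0"
      unfolding Al .
  qed
  moreover have "\<phi> {} = 0"
  proof -
    have "\<mu> {} = 0"
      using additiveD[OF \<mu>_additive, of "{}" "{}"] by simp
    moreover have "\<psi> {} = 0"
      using assms(3) unfolding weakly_infinite_alternating_def weakly_k_alternating_def by blast
    ultimately show ?thesis by (simp add: \<phi>_def)
  qed
  ultimately have "infinite_alternating \<B> \<phi>"
    by (intro infinite_alternatingI[OF assms(1)])
  then show ?thesis
    using \<mu>_additive \<mu>_nonneg by (intro exI[of _ \<phi>] exI[of _ \<mu>]) (simp add: charge_def \<phi>_def)
qed

end
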